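(* Fix an integer $m>0$ and let $\lambda_m:\mathbb Q[p_r\mid r>0]\to\mathbb Q[p_r\mid r>0]$ be the algebra homomorphism defined by $\lambda_m(p_r)=p_{mr}$ for all $r>0$. Then the $\mathbb Z$-subalgebra $\mathbb Z^{(sym)}[p_r\mid r>0]=\mathbb Z[\hat p_k\mid k>0]$ is $\lambda_m$-stable.
   Context: $\mathbb Q[p_r\mid r>0]$ is the polynomial algebra in the indeterminates $p_1,p_2,\dots$. The elements $\hat p_k$ are defined by $\hat p(u)=\sum_{k\ge0}\hat p_ku^k=\exp\big(\sum_{r>0}(-1)^{r-1}\frac{p_r}{r}u^r\big)$, and $\mathbb Z^{(sym)}[p_r\mid r>0]$ denotes the $\mathbb Z$-subalgebra $\mathbb Z[\hat p_k\mid k>0]$ generated by them. *)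

theory Defs
  imports
    "HOL-Library.Poly_Mapping"
    "HOL-Computational_Algebra.Formal_Power_Series"
begin

text \<open>Polynomials over the rationals in indeterminates \<open>p\<^sub>1, p\<^sub>2, \<dots>\<close>: finitely supported
  functions from monomials to coefficients, with convolution as product. Monomials are finitely
  supported exponent functions on \<^typ>\<open>nat\<close>; the exponent of \<open>p\<^sub>r\<close> (for \<open>r > 0\<close>) is stored at
  position \<open>r - 1\<close>, so that exactly the positive indices name indeterminates.\<close>

type_synonym qpoly = "(nat \<Rightarrow>\<^sub>0 nat) \<Rightarrow>\<^sub>0 rat"

text \<open>Only meaningful for \<open>r > 0\<close> (truncated subtraction makes \<open>pvar 0 = pvar 1\<close>).\<close>

definition pvar :: "nat \<Rightarrow> qpoly" where
  "pvar r = Poly_Mapping.single (Poly_Mapping.single (r - 1) 1) 1"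

definition qconst :: "rat \<Rightarrow> qpoly" where
  "qconst c = Poly_Mapping.single 0 c"

text \<open>The library's \<open>fps_exp\<close> needs coefficients in a field, so the series \<open>exp(u)\<close> over the
  polynomial ring is written out. The exponent substituted into it in \<open>p_hat_series\<close> has zero
  constant term, so \<open>oo\<close> is genuine composition of power series.\<close>

definition exp_series :: "qpoly fps" where
  "exp_series = Abs_fps (\<lambda>n. qconst (1 / fact n))"

definition p_hat_series :: "qpoly fps" where
  "p_hat_series = exp_series oo
     Abs_fps (\<lambda>r. if r = 0 then 0 else (-1) ^ (r - 1) * qconst (1 / of_nat r) * pvar r)"

definition p_hat :: "nat \<Rightarrow> qpoly" where
  "p_hat k = fps_nth p_hat_series k"

text \<open>Unital \<open>\<int>\<close>-subalgebras of a commutative ring are its subrings containing 1.\<close>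

definition int_subalgebra :: "'a::comm_ring_1 set \<Rightarrow> bool" where
  "int_subalgebra A \<longleftrightarrow>
     1 \<in> A \<and> (\<forall>x\<in>A. \<forall>y\<in>A. x - y \<in> A) \<and> (\<forall>x\<in>A. \<forall>y\<in>A. x * y \<in> A)"

definition Zsym :: "qpoly set" where
  "Zsym = int_subalgebra hull {p_hat k |k. k > 0}"

definition rat_algebra_hom :: "(qpoly \<Rightarrow> qpoly) \<Rightarrow> bool" where
  "rat_algebra_hom f \<longleftrightarrow>
     f 1 = 1 \<and> (\<forall>x y. f (x + y) = f x + f y) \<and> (\<forall>x y. f (x * y) = f x * f y) \<and>
     (\<forall>c x. f (qconst c * x) = qconst c * f x)"

text \<open>The rest of the theory shows that a homomorphism is determined by arbitrary prescribed images of
  the indeterminates, so that the homomorphism sending \<open>p\<^sub>r\<close> to \<open>p\<^sub>m\<^sub>r\<close> is well defined.\<close>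

lemma poly_mapping_decomp: "(f :: 'a \<Rightarrow>\<^sub>0 'b::comm_monoid_add) =
    (\<Sum>a\<in>Poly_Mapping.keys f. Poly_Mapping.single a (Poly_Mapping.lookup f a))"
  by (rule poly_mapping_eqI)
     (auto simp: lookup_sum lookup_single when_def sum.delta in_keys_iff)

lemma poly_mapping_add_induct [case_names zero single add]:
  fixes f :: "'a \<Rightarrow>\<^sub>0 'b::comm_monoid_add"
  assumes "P 0" "\<And>a c. P (Poly_Mapping.single a c)" "\<And>f g. P f \<Longrightarrow> P g \<Longrightarrow> P (f + g)"
  shows "P f"
proof -
  have "P (\<Sum>a\<in>A. Poly_Mapping.single a (Poly_Mapping.lookup f a))" if "finite A" for A
    using that by induction (auto intro: assms)
  then show ?thesis by (subst poly_mapping_decomp) auto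
qed

definition monom_subst :: "(nat \<Rightarrow> qpoly) \<Rightarrow> (nat \<Rightarrow>\<^sub>0 nat) \<Rightarrow> qpoly" where
  "monom_subst x a = (\<Prod>i\<in>Poly_Mapping.keys a. x (Suc i) ^ Poly_Mapping.lookup a i)"

definition qpoly_subst :: "(nat \<Rightarrow> qpoly) \<Rightarrow> qpoly \<Rightarrow> qpoly" where
  "qpoly_subst x f =
     (\<Sum>a\<in>Poly_Mapping.keys f. qconst (Poly_Mapping.lookup f a) * monom_subst x a)"

lemma qconst_add: "qconst (c + d) = qconst c + qconst d"
  by (simp add: qconst_def single_add)

lemma qconst_mult: "qconst (c * d) = qconst c * qconst d"
  by (simp add: qconst_def mult_single)

lemma qconst_0 [simp]: "qconst 0 = 0" and qconst_1 [simp]: "qconst 1 = 1"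
  by (simp_all add: qconst_def)

lemma monom_subst_superset:
  assumes "finite S" "Poly_Mapping.keys a \<subseteq> S"
  shows "monom_subst x a = (\<Prod>i\<in>S. x (Suc i) ^ Poly_Mapping.lookup a i)"
  unfolding monom_subst_def
  by (rule prod.mono_neutral_left) (use assms in \<open>auto simp: in_keys_iff\<close>)

lemma monom_subst_add: "monom_subst x (a + b) = monom_subst x a * monom_subst x b"
proof -
  let ?S = "Poly_Mapping.keys a \<union> Poly_Mapping.keys b"
  show ?thesis
    using keys_add[of a b]
    by (simp add: monom_subst_superset[of ?S] lookup_add power_add prod.distrib)
qed

lemma qpoly_subst_superset:
  assumes "finite S" "Poly_Mapping.keys f \<subseteq> S"
  shows "qpoly_subst x f = (\<Sum>a\<in>S. qconst (Poly_Mapping.lookup f a) * monom_subst x a)"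
  unfolding qpoly_subst_def
  by (rule sum.mono_neutral_left) (use assms in \<open>auto simp: in_keys_iff\<close>)

lemma qpoly_subst_add: "qpoly_subst x (f + g) = qpoly_subst x f + qpoly_subst x g"
proof -
  let ?S = "Poly_Mapping.keys f \<union> Poly_Mapping.keys g"
  show ?thesis
    using keys_add[of f g]
    by (simp add: qpoly_subst_superset[of ?S] lookup_add qconst_add algebra_simps sum.distrib)
qed

lemma qpoly_subst_single: "qpoly_subst x (Poly_Mapping.single a c) = qconst c * monom_subst x a"
  by (subst qpoly_subst_superset[of "{a}"]) auto

lemma qpoly_subst_0 [simp]: "qpoly_subst x 0 = 0"
  by (simp add: qpoly_subst_def)

lemma qpoly_subst_mult: "qpoly_subst x (f * g) = qpoly_subst x f * qpoly_subst x g"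
proof (induction f rule: poly_mapping_add_induct)
  case (single a c)
  show ?case
  proof (induction g rule: poly_mapping_add_induct)
    case (single b d)
    show ?case
      by (simp add: mult_single qpoly_subst_single monom_subst_add qconst_mult algebra_simps)
  qed (simp_all add: qpoly_subst_add algebra_simps)
qed (simp_all add: qpoly_subst_add algebra_simps)

lemma monom_subst_0 [simp]: "monom_subst x 0 = 1"
  by (simp add: monom_subst_def)

lemma qpoly_subst_qconst: "qpoly_subst x (qconst c) = qconst c"
  by (subst (1) qconst_def) (simp add: qpoly_subst_single)

lemma rat_algebra_hom_qpoly_subst: "rat_algebra_hom (qpoly_subst x)"
  using qpoly_subst_qconst[of x 1]
  by (simp add: rat_algebra_hom_def qpoly_subst_add qpoly_subst_mult qpoly_subst_qconst)

lemma qpoly_subst_pvar: "r > 0 \<Longrightarrow> qpoly_subst x (pvar r) = x r"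
  by (simp add: pvar_def qpoly_subst_single monom_subst_def)

lemma rat_algebra_hom_unique:
  assumes f: "rat_algebra_hom f" and g: "rat_algebra_hom g"
    and eq: "\<And>r. r > 0 \<Longrightarrow> f (pvar r) = g (pvar r)"
  shows "f = g"
proof
  fix y
  note F = f[unfolded rat_algebra_hom_def] and G = g[unfolded rat_algebra_hom_def]
  have monom: "f (Poly_Mapping.single a 1) = g (Poly_Mapping.single a 1)" for a
  proof (induction a rule: poly_mapping_add_induct)
    case zero
    show ?case using F G by simp
  next
    case (single i n)
    have "Poly_Mapping.single (Poly_Mapping.single i n) 1 = pvar (Suc i) ^ n"
    proof (induction n)
      case (Suc n)
      have "pvar (Suc i) ^ Suc n =
          pvar (Suc i) * Poly_Mapping.single (Poly_Mapping.single i n) 1"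
        by (simp add: Suc)
      also have "\<dots> = Poly_Mapping.single (Poly_Mapping.single i (Suc n)) 1"
        by (simp add: pvar_def mult_single single_add[symmetric])
      finally show ?case by simp
    qed simp
    moreover have "f (pvar (Suc i) ^ n) = g (pvar (Suc i) ^ n)"
      by (induction n) (use F G eq in auto)
    ultimately show ?case by simp
  next
    case (add a b)
    have "Poly_Mapping.single (a + b) 1 =
        Poly_Mapping.single a 1 * (Poly_Mapping.single b 1 :: qpoly)"
      by (simp add: mult_single)
    then show ?case using F G add by simp
  qed
  show "f y = g y"
  proof (induction y rule: poly_mapping_add_induct)
    case zero
    have "f (qconst 0 * 0) = qconst 0 * f 0" "g (qconst 0 * 0) = qconst 0 * g 0"
      using F G by blast+
    then show ?case by simp
  next
    case (single a c)
    have "Poly_Mapping.single a c = qconst c * Poly_Mapping.single a 1"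
      by (simp add: qconst_def mult_single)
    then show ?case using F G monom by metis
  next
    case (add y z)
    then show ?case using F G by simp
  qed
qed

lemma ex1_rat_algebra_hom: "\<exists>!f. rat_algebra_hom f \<and> (\<forall>r>0. f (pvar r) = x r)"
proof (rule ex1I[of _ "qpoly_subst x"])
  show "rat_algebra_hom (qpoly_subst x) \<and> (\<forall>r>0. qpoly_subst x (pvar r) = x r)"
    using rat_algebra_hom_qpoly_subst qpoly_subst_pvar by blast
next
  fix f assume "rat_algebra_hom f \<and> (\<forall>r>0. f (pvar r) = x r)"
  then show "f = qpoly_subst x"
    by (intro rat_algebra_hom_unique) (auto simp: rat_algebra_hom_qpoly_subst qpoly_subst_pvar)
qed

end

theory Submission
  imports Defs
begin

unbundle fps_syntax

text \<open>Write \<open>H(u) = \<Sum>\<^sub>k p_hat k (-u)\<^sup>k\<close>. Its coefficients generate the same ring, and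
  \<open>- u H'(u) / H(u) = \<Sum>\<^sub>r p\<^sub>r u\<^sup>r\<close>. As for Witt vectors, one has \<open>H(u) = \<Prod>\<^sub>n (1 - a\<^sub>n u\<^sup>n)\<close> with \<open>a\<^sub>n\<close>
  in the ring, that is \<open>p\<^sub>r = \<Sum>\<^bsub>n | r\<^esub> n a\<^sub>n\<^bsup>r/n\<^esup>\<close>. With \<open>g = gcd n m\<close>, the terms
  \<open>n a\<^sub>n\<^bsup>mr/n\<^esup>\<close> of \<open>p\<^bsub>mr\<^esub>\<close> are those coming from the factor \<open>(1 - a\<^sub>n\<^bsup>m/g\<^esup> u\<^bsup>n/g\<^esup>)\<^sup>g\<close>; so the image
  of \<open>H\<close> is the product of these factors, whose coefficients visibly lie in the ring.\<close>

section \<open>Logarithmic derivatives of power series\<close>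

text \<open>The relation \<open>P = - X F' / F\<close> cleared of its denominator, so that it makes
  sense over any commutative ring.\<close>

definition neg_log_deriv :: "'a::comm_ring_1 fps \<Rightarrow> 'a fps \<Rightarrow> bool" where
  "neg_log_deriv F P \<longleftrightarrow> fps_X * fps_deriv F = - (F * P)"

lemma fps_X_deriv_nth: "(fps_X * fps_deriv F) $ n = of_nat n * F $ n"
  by (cases n) auto

text \<open>Newton's identities; the two comparison lemmas below are inductions on them.\<close>

lemma neg_log_deriv_iff:
  "neg_log_deriv F P \<longleftrightarrow> (\<forall>n. of_nat n * F $ n = - (\<Sum>i=0..n. F $ i * P $ (n - i)))"
  unfolding neg_log_deriv_def fps_eq_iff fps_X_deriv_nth by (simp add: fps_mult_nth)

lemma neg_log_deriv_1: "neg_log_deriv 1 0"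
  by (simp add: neg_log_deriv_def)

lemma neg_log_deriv_mult:
  assumes "neg_log_deriv F P" "neg_log_deriv G Q"
  shows "neg_log_deriv (F * G) (P + Q)"
proof -
  have "fps_X * fps_deriv (F * G) = F * (fps_X * fps_deriv G) + (fps_X * fps_deriv F) * G"
    by (simp add: algebra_simps)
  also have "\<dots> = - (F * G * (P + Q))"
    using assms by (simp add: neg_log_deriv_def algebra_simps)
  finally show ?thesis by (simp add: neg_log_deriv_def)
qed

lemma neg_log_deriv_prod:
  "(\<And>i. i \<in> A \<Longrightarrow> neg_log_deriv (F i) (P i)) \<Longrightarrow>
    neg_log_deriv (\<Prod>i\<in>A. F i) (\<Sum>i\<in>A. P i)"
  by (induction A rule: infinite_finite_induct)
     (auto intro: neg_log_deriv_1 neg_log_deriv_mult)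

lemma neg_log_deriv_power:
  "neg_log_deriv F P \<Longrightarrow> neg_log_deriv (F ^ n) (of_nat n * P)"
  using neg_log_deriv_prod[of "{..<n}" "\<lambda>_. F" "\<lambda>_. P"] by simp

text \<open>The series \<open>- X d/dX log (1 - c X^n)\<close>, a multiple of a geometric series in
  \<open>X^n\<close>.\<close>

definition binomial_log :: "'a::comm_ring_1 \<Rightarrow> nat \<Rightarrow> 'a fps" where
  "binomial_log c n = Abs_fps (\<lambda>r. if r > 0 \<and> n dvd r then of_nat n * c ^ (r div n) else 0)"

lemma neg_log_deriv_binomial:
  assumes "n > 0"
  shows "neg_log_deriv (1 - fps_const c * fps_X ^ n) (binomial_log c n)"
proof -
  let ?P = "binomial_log c n" and ?F = "1 - fps_const c * fps_X ^ n"
  have "(fps_X * fps_deriv ?F) $ r = - ((?F * ?P) $ r)" for r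
  proof -
    have "(?F * ?P) $ r = ?P $ r - c * (if r < n then 0 else ?P $ (r - n))"
      by (simp add: left_diff_distrib mult.assoc fps_X_power_mult_nth)
    \<comment> \<open>Against \<open>1 - c X^n\<close> the geometric series telescopes; only its
      first term, at \<open>n\<close>, survives.\<close>
    also have "\<dots> = (if r = n then of_nat n * c else 0)"
    proof (cases r n rule: linorder_cases)
      case greater
      then obtain s where s: "r = n + s" "s > 0" by (metis less_imp_add_positive)
      show ?thesis
        using assms s by (simp add: binomial_log_def div_add_self1)
    qed (use assms in \<open>auto simp: binomial_log_def dest: dvd_imp_le\<close>)
    finally show ?thesis
      using assms unfolding fps_X_deriv_nth by simp
  qed
  then show ?thesis by (simp add: neg_log_deriv_def fps_eq_iff)
qed

text \<open>The \<open>k\<close>-th Newton identity contains \<open>P $ k\<close> with coefficient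
  \<open>F $ 0 = 1\<close>, so it can be solved for \<open>P $ k\<close> without division.\<close>

lemma neg_log_deriv_nth_cong:
  assumes P: "neg_log_deriv F P" and Q: "neg_log_deriv G Q"
    and F0: "F $ 0 = 1"
    and eq: "\<And>k. k \<le> N \<Longrightarrow> F $ k = G $ k" and "k \<le> N"
  shows "P $ k = Q $ k"
  using \<open>k \<le> N\<close>
proof (induction k rule: less_induct)
  case (less k)
  have G0: "G $ 0 = 1" using F0 eq[of 0] by simp
  have "(\<Sum>i=0..k. F $ i * P $ (k - i)) = (\<Sum>i=0..k. G $ i * Q $ (k - i))"
    using P Q eq[OF less.prems] unfolding neg_log_deriv_iff by (metis neg_equal_iff_equal)
  moreover have "(\<Sum>i=Suc 0..k. F $ i * P $ (k - i)) = (\<Sum>i=Suc 0..k. G $ i * Q $ (k - i))"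
    using less by (intro sum.cong) (auto simp: eq)
  ultimately show ?case
    by (simp add: sum.atLeast_Suc_atMost F0 G0)
qed

text \<open>Conversely, \<open>P $ 0 = 0\<close> removes \<open>F $ k\<close> from the convolution,
  so \<open>k * F $ k\<close> is expressed through lower coefficients of \<open>F\<close>;
  cancelling \<open>k\<close> is where characteristic 0 enters.\<close>

lemma nth_cong_neg_log_deriv:
  fixes F G :: "'a::{idom, ring_char_0} fps"
  assumes P: "neg_log_deriv F P" and Q: "neg_log_deriv G Q"
    and F0: "F $ 0 = G $ 0" and P0: "P $ 0 = 0"
    and eq: "\<And>k. k \<le> N \<Longrightarrow> P $ k = Q $ k" and "k \<le> N"
  shows "F $ k = G $ k"
  using \<open>k \<le> N\<close>
proof (induction k rule: less_induct)
  case (less k)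
  have Q0: "Q $ 0 = 0" using P0 eq[of 0] by simp
  show ?case
  proof (cases "k = 0")
    case False
    have "F $ i * P $ (k - i) = G $ i * Q $ (k - i)" if "i \<in> {0..k}" for i
      using that less P0 Q0 by (cases "i = k") (auto simp: eq)
    then have "(\<Sum>i=0..k. F $ i * P $ (k - i)) = (\<Sum>i=0..k. G $ i * Q $ (k - i))"
      by (rule sum.cong[OF refl])
    then have "of_nat k * F $ k = of_nat k * G $ k"
      using P Q unfolding neg_log_deriv_iff by simp
    then show ?thesis using False by simp
  qed (simp add: F0)
qed

section \<open>Subrings and power series\<close>

lemma int_subalgebra_0: "int_subalgebra A \<Longrightarrow> 0 \<in> A"
  unfolding int_subalgebra_def by (metis diff_self)

lemma int_subalgebra_minus: "int_subalgebra A \<Longrightarrow> x \<in> A \<Longrightarrow> - x \<in> A"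
  using int_subalgebra_0[of A] unfolding int_subalgebra_def by (metis diff_0)

lemma int_subalgebra_add: "int_subalgebra A \<Longrightarrow> x \<in> A \<Longrightarrow> y \<in> A \<Longrightarrow> x + y \<in> A"
  using int_subalgebra_minus[of A y] unfolding int_subalgebra_def by (metis diff_minus_eq_add)

lemma int_subalgebra_sum:
  "int_subalgebra A \<Longrightarrow> (\<And>i. i \<in> I \<Longrightarrow> f i \<in> A) \<Longrightarrow> sum f I \<in> A"
  by (induction I rule: infinite_finite_induct) (auto intro: int_subalgebra_0 int_subalgebra_add)

lemma int_subalgebra_prod:
  "int_subalgebra A \<Longrightarrow> (\<And>i. i \<in> I \<Longrightarrow> f i \<in> A) \<Longrightarrow> prod f I \<in> A"
  by (induction I rule: infinite_finite_induct) (auto simp: int_subalgebra_def)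

lemma int_subalgebra_power: "int_subalgebra A \<Longrightarrow> x \<in> A \<Longrightarrow> x ^ n \<in> A"
  using int_subalgebra_prod[of A "{..<n}" "\<lambda>_. x"] by simp

lemma int_subalgebra_fps:
  assumes "int_subalgebra A"
  shows "int_subalgebra {F. \<forall>k. F $ k \<in> A}"
  unfolding int_subalgebra_def[of "Collect _"]
  using assms int_subalgebra_0[OF assms]
  by (auto simp: fps_mult_nth int_subalgebra_def intro!: int_subalgebra_sum)

lemma int_subalgebra_binomial_fps:
  assumes A: "int_subalgebra A" and "c \<in> A"
  shows "1 - fps_const c * fps_X ^ n \<in> {F. \<forall>k. F $ k \<in> A}"
  using assms int_subalgebra_0[OF A] int_subalgebra_minus[OF A]
  by (auto simp: int_subalgebra_def)

lemma int_subalgebra_hull: "int_subalgebra (int_subalgebra hull S)"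
  by (rule hull_in) (auto simp: int_subalgebra_def)

section \<open>Witt factorisation\<close>

text \<open>Each new factor corrects the coefficient at its own exponent to that of \<open>F\<close>
  and leaves the lower ones unchanged.\<close>

primrec witt_prod :: "'a::comm_ring_1 fps \<Rightarrow> nat \<Rightarrow> 'a fps" where
  "witt_prod F 0 = 1"
| "witt_prod F (Suc n) = witt_prod F n *
     (1 - fps_const (witt_prod F n $ Suc n - F $ Suc n) * fps_X ^ Suc n)"

definition witt_coord :: "'a::comm_ring_1 fps \<Rightarrow> nat \<Rightarrow> 'a" where
  "witt_coord F n = witt_prod F (n - 1) $ n - F $ n"

lemma witt_prod_eq:
  "witt_prod F N = (\<Prod>n=1..N. 1 - fps_const (witt_coord F n) * fps_X ^ n)"
  by (induction N) (auto simp: witt_coord_def)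

lemma witt_prod_nth_0: "witt_prod F N $ 0 = 1"
  by (induction N) (auto simp del: power_Suc)

lemma witt_prod_nth:
  assumes "F $ 0 = 1" "k \<le> N"
  shows "witt_prod F N $ k = F $ k"
  using \<open>k \<le> N\<close>
proof (induction N)
  case (Suc N)
  have "witt_prod F (Suc N) $ k = witt_prod F N $ k -
      (witt_prod F N $ Suc N - F $ Suc N) * (if k < Suc N then 0 else witt_prod F N $ (k - Suc N))"
    by (simp add: right_diff_distrib mult.left_commute[of _ "fps_const _"]
        fps_X_power_mult_right_nth del: power_Suc)
  then show ?case
    using Suc by (cases "k = Suc N") (auto simp: witt_prod_nth_0)
qed (use assms in simp)

text \<open>The recursion for the coordinates uses ring operations only, never division.\<close>

lemma witt_coord_in:
  assumes A: "int_subalgebra A" and F: "\<And>k. F $ k \<in> A"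
  shows "witt_coord F n \<in> A"
proof -
  have "witt_prod F N \<in> {F. \<forall>k. F $ k \<in> A}" for N
  proof (induction N)
    case 0
    show ?case using int_subalgebra_fps[OF A] by (simp add: int_subalgebra_def)
  next
    case (Suc N)
    have "witt_prod F N $ Suc N - F $ Suc N \<in> A"
      using Suc F A by (auto simp: int_subalgebra_def)
    from int_subalgebra_binomial_fps[OF A this, of "Suc N"] Suc show ?case
      using int_subalgebra_fps[OF A] unfolding int_subalgebra_def[of "Collect _"] witt_prod.simps
      by blast
  qed
  then show ?thesis
    using A F by (auto simp: witt_coord_def int_subalgebra_def)
qed

text \<open>Since \<open>n' = n / g\<close> and \<open>m' = m / g\<close> are coprime,
  \<open>n\<close> divides \<open>m r\<close> exactly when \<open>n'\<close> divides
  \<open>r\<close>, and then \<open>m r / n = m' (r / n')\<close>.\<close>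

lemma binomial_log_dilate:
  fixes c :: "'a::comm_ring_1"
  assumes "m > 0" "n > 0"
  defines "g \<equiv> gcd n m"
  shows "of_nat g * binomial_log (c ^ (m div g)) (n div g) $ r = binomial_log c n $ (m * r)"
proof -
  define n' m' where "n' = n div g" and "m' = m div g"
  have "g > 0" "g dvd n" "g dvd m"
    using assms by (auto simp: g_def)
  then have nm: "n = g * n'" "m = g * m'"
    by (simp_all add: n'_def m'_def)
  have "coprime n' m'"
    using assms(1) by (simp add: n'_def m'_def g_def div_gcd_coprime)
  then have "n dvd m * r \<longleftrightarrow> n' dvd r"
    using \<open>g > 0\<close> unfolding nm by (simp add: mult.assoc coprime_dvd_mult_right_iff)
  moreover have "m * r div n = m' * (r div n')" if "n' dvd r"
    using \<open>g > 0\<close> that unfolding nm by (simp add: mult.assoc div_mult_swap)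
  moreover have "of_nat n = (of_nat g * of_nat n' :: 'a)"
    unfolding nm by simp
  ultimately show ?thesis
    using \<open>m > 0\<close> unfolding n'_def[symmetric] m'_def[symmetric]
    by (auto simp: binomial_log_def power_mult mult.assoc)
qed

text \<open>No map occurs here: \<open>Q\<close> and the constant term 1 already pin down
  \<open>G\<close>, which is compared with an explicit product over \<open>A\<close>.\<close>

lemma dilated_log_series_in:
  fixes F G :: "'a::{idom, ring_char_0} fps"
  assumes A: "int_subalgebra A" and F: "\<And>k. F $ k \<in> A" and "m > 0"
    and F0: "F $ 0 = 1" and G0: "G $ 0 = 1"
    and P: "neg_log_deriv F P" and Q: "neg_log_deriv G Q"
    and Q_nth: "\<And>r. Q $ r = P $ (m * r)"
  shows "G $ k \<in> A"
proof -
  define a where "a = witt_coord F"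
  \<comment> \<open>Coefficients of \<open>Q\<close> up to \<open>k\<close> are coefficients of
    \<open>P\<close> up to \<open>m * k\<close>, so a finite Witt product suffices.\<close>
  define N where "N = m * k"
  define g where "g n = gcd n m" for n
  define R where "R = (\<Prod>n=1..N. (1 - fps_const (a n ^ (m div g n)) * fps_X ^ (n div g n)) ^ g n)"
  define L where "L = (\<Sum>n=1..N. of_nat (g n) * binomial_log (a n ^ (m div g n)) (n div g n))"
  have div_pos: "n div g n > 0" if "n > 0" for n
    using that by (auto simp: g_def div_greater_zero_iff intro: gcd_le1_nat)
  have "neg_log_deriv (witt_prod F N) (\<Sum>n=1..N. binomial_log (a n) n)"
    unfolding witt_prod_eq a_def by (rule neg_log_deriv_prod) (simp add: neg_log_deriv_binomial)
  \<comment> \<open>The finite product agrees with \<open>F\<close> up to \<open>N\<close>, hence so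
    do the logarithmic derivatives.\<close>
  from neg_log_deriv_nth_cong[OF P this F0, of N]
  have P_nth: "P $ r = (\<Sum>n=1..N. binomial_log (a n) n $ r)" if "r \<le> N" for r
    using that by (simp add: witt_prod_nth F0 fps_sum_nth)
  have R_log: "neg_log_deriv R L"
    unfolding R_def L_def
    by (intro neg_log_deriv_prod neg_log_deriv_power neg_log_deriv_binomial div_pos) simp
  have L_nth: "L $ r = Q $ r" if "r \<le> k" for r
  proof -
    have "L $ r = (\<Sum>n=1..N. binomial_log (a n) n $ (m * r))"
      unfolding L_def fps_sum_nth g_def
      by (intro sum.cong refl)
         (simp add: fps_of_nat[symmetric] binomial_log_dilate \<open>m > 0\<close>)
    then show ?thesis
      using that by (simp add: Q_nth P_nth N_def)
  qed
  have R0: "R $ 0 = 1"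
  proof -
    have "R $ 0 = (\<Prod>n=1..N. (1 - a n ^ (m div g n) * 0 ^ (n div g n)) ^ g n)"
      by (simp add: R_def fps_prod_nth' fps_power_zeroth)
    also have "\<dots> = 1"
      by (intro prod.neutral) (auto simp: zero_power div_pos)
    finally show ?thesis .
  qed
  have "L $ 0 = 0"
    by (simp add: L_def fps_sum_nth binomial_log_def)
  then have "R $ k = G $ k"
    using nth_cong_neg_log_deriv[OF R_log Q, of k k] R0 G0 L_nth by simp
  moreover have "R \<in> {F. \<forall>k. F $ k \<in> A}"
    unfolding R_def a_def
    by (intro int_subalgebra_prod int_subalgebra_power int_subalgebra_fps
        int_subalgebra_binomial_fps witt_coord_in A F)
  ultimately show ?thesis by (metis mem_Collect_eq)
qed

section \<open>The generating series of the symmetric integral form\<close>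

definition p_series :: "qpoly fps" where
  "p_series = Abs_fps (\<lambda>r. if r = 0 then 0 else pvar r)"

text \<open>If \<open>pvar r\<close> is read as the power sum in variables \<open>x_i\<close>, this
  is the product of the \<open>1 - x_i u\<close>, and \<open>p_hat k\<close> is the elementary
  symmetric function.\<close>

definition alt_p_hat_series :: "qpoly fps" where
  "alt_p_hat_series = Abs_fps (\<lambda>k. (-1) ^ k * p_hat k)"

lemma of_nat_mult_qconst: "of_nat n * qconst c = qconst (of_nat n * c)"
  by (induction n) (auto simp: algebra_simps qconst_add)

lemma p_hat_0: "p_hat 0 = 1"
  by (simp add: p_hat_def p_hat_series_def exp_series_def fps_compose_nth_0)

lemma fps_deriv_exp_series: "fps_deriv exp_series = exp_series"
proof (rule fps_ext)
  fix n
  have "of_nat (n + 1) * (1 / fact (n + 1)) = (1 / fact n :: rat)"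
    by (simp add: field_simps del: of_nat_Suc)
  then show "fps_deriv exp_series $ n = exp_series $ n"
    unfolding fps_deriv_nth by (simp add: exp_series_def of_nat_mult_qconst del: of_nat_Suc)
qed

text \<open>The chain rule for \<open>exp\<close> gives a Newton recursion for \<open>p_hat\<close>;
  replacing \<open>u\<close> by \<open>-u\<close> is then carried out on coefficients.\<close>

lemma neg_log_deriv_alt_p_hat_series: "neg_log_deriv alt_p_hat_series p_series"
proof -
  define L :: "qpoly fps" where
    "L = Abs_fps (\<lambda>r. if r = 0 then 0 else (-1) ^ (r - 1) * qconst (1 / of_nat r) * pvar r)"
  have E: "p_hat_series = exp_series oo L"
    by (simp add: p_hat_series_def L_def)
  \<comment> \<open>The factor \<open>1 / r\<close> cancels against the derivative; what remains is
    \<open>- p_series\<close> at \<open>-u\<close>.\<close>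
  have XL: "(fps_X * fps_deriv L) $ r = - ((-1) ^ r * p_series $ r)" for r
  proof (cases r)
    case (Suc s)
    have "of_nat r * qconst (1 / of_nat r) = 1"
      using Suc by (simp add: of_nat_mult_qconst del: of_nat_Suc)
    then have "of_nat r * ((-1) ^ s * qconst (1 / of_nat r) * pvar r) = (-1) ^ s * pvar r"
      by (metis (no_types, lifting) mult.assoc mult.left_commute mult.right_neutral)
    then show ?thesis
      unfolding fps_X_deriv_nth using Suc by (simp add: L_def p_series_def del: of_nat_Suc)
  qed (simp add: p_series_def)
  have "fps_deriv p_hat_series = p_hat_series * fps_deriv L"
    unfolding E by (simp add: fps_compose_deriv fps_deriv_exp_series L_def)
  then have "(fps_X * fps_deriv p_hat_series) $ n = (p_hat_series * (fps_X * fps_deriv L)) $ n" for n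
    by (simp only: mult.left_commute)
  then have E_nth: "of_nat n * p_hat n =
      - (\<Sum>i=0..n. p_hat i * ((-1) ^ (n - i) * p_series $ (n - i)))" for n
    unfolding fps_mult_nth[of p_hat_series] XL
    by (simp only: fps_X_deriv_nth p_hat_def mult_minus_right sum_negf)
  have sign: "(-1) ^ n * (p_hat i * ((-1) ^ (n - i) * p_series $ (n - i))) =
      (-1) ^ i * p_hat i * p_series $ (n - i)" if "i \<le> n" for i n
  proof -
    obtain j where n: "n = i + j"
      using le_Suc_ex[OF \<open>i \<le> n\<close>] by auto
    have "(-1) ^ n * (p_hat i * ((-1) ^ (n - i) * p_series $ (n - i))) =
        ((-1) ^ n * (-1) ^ (n - i)) * (p_hat i * p_series $ (n - i))"
      by (simp only: mult_ac)
    also have "(-1) ^ n * (-1) ^ (n - i) = ((-1) ^ i :: qpoly)"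
      by (simp add: n power_add mult.assoc)
    finally show ?thesis by (simp only: mult.assoc)
  qed
  have "of_nat n * ((-1) ^ n * p_hat n) =
      - (\<Sum>i=0..n. (-1) ^ i * p_hat i * p_series $ (n - i))" for n
  proof -
    have "of_nat n * ((-1) ^ n * p_hat n) = (-1) ^ n * (of_nat n * p_hat n)"
      by (simp only: mult.left_commute)
    also have "\<dots> = - (\<Sum>i=0..n. (-1) ^ n * (p_hat i * ((-1) ^ (n - i) * p_series $ (n - i))))"
      unfolding E_nth by (simp only: mult_minus_right sum_distrib_left)
    also have "\<dots> = - (\<Sum>i=0..n. (-1) ^ i * p_hat i * p_series $ (n - i))"
      by (simp add: sign)
    finally show ?thesis .
  qed
  then show ?thesis
    unfolding neg_log_deriv_iff alt_p_hat_series_def by simp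
qed

text \<open>The generators start at index 1; \<open>p_hat 0\<close> is the unit.\<close>

lemma p_hat_in_Zsym: "p_hat k \<in> Zsym"
proof (cases "k = 0")
  case True
  have "1 \<in> Zsym"
    using int_subalgebra_hull unfolding Zsym_def int_subalgebra_def by blast
  then show ?thesis
    by (simp add: True p_hat_0)
next
  case False
  then show ?thesis
    unfolding Zsym_def by (intro hull_inc) auto
qed

text \<open>Allows passing between \<open>p_hat\<close> and \<open>alt_p_hat_series\<close> when
  testing membership.\<close>

lemma int_subalgebra_sign_iff:
  assumes "int_subalgebra A"
  shows "(-1) ^ k * x \<in> A \<longleftrightarrow> x \<in> A"
  using int_subalgebra_minus[OF assms, of x] int_subalgebra_minus[OF assms, of "- x"]
  by (cases "even k") auto

theorem proposition2p18:
  fixes m :: nat and lam :: "qpoly \<Rightarrow> qpoly"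
  assumes "m > 0"
    and "rat_algebra_hom lam"
    and "\<And>r. r > 0 \<Longrightarrow> lam (pvar r) = pvar (m * r)"
  shows "lam ` Zsym \<subseteq> Zsym"
proof -
  have Z: "int_subalgebra Zsym"
    unfolding Zsym_def by (rule int_subalgebra_hull)
  have one: "lam 1 = 1" and add: "lam (x + y) = lam x + lam y"
    and mult: "lam (x * y) = lam x * lam y" for x y
    using assms(2) by (auto simp: rat_algebra_hom_def)
  have zero: "lam 0 = 0" using add[of 0 0] by simp
  have minus: "lam (- x) = - lam x" for x
    using add[of x "- x"] zero by (simp add: eq_neg_iff_add_eq_0 add.commute)
  have diff: "lam (x - y) = lam x - lam y" for x y
    using add[of x "- y"] minus by simp
  have sum: "lam (sum f I) = (\<Sum>i\<in>I. lam (f i))" for f :: "nat \<Rightarrow> qpoly" and I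
    by (induction I rule: infinite_finite_induct) (auto simp: zero add)
  have nat: "lam (of_nat n) = of_nat n" for n
    by (induction n) (auto simp: zero one add)
  have sign: "lam ((-1) ^ n) = (-1) ^ n" for n
    by (induction n) (auto simp: one mult minus)
  define F where "F = alt_p_hat_series"
  define G where "G = Abs_fps (\<lambda>k. lam (F $ k))"
  define Q where "Q = Abs_fps (\<lambda>k. lam (p_series $ k))"
  have P: "neg_log_deriv F p_series"
    unfolding F_def by (rule neg_log_deriv_alt_p_hat_series)
  \<comment> \<open>A ring homomorphism carries Newton's identities to Newton's identities.\<close>
  have Q: "neg_log_deriv G Q"
    unfolding neg_log_deriv_iff
  proof
    fix n
    have "lam (of_nat n * F $ n) = lam (- (\<Sum>i=0..n. F $ i * p_series $ (n - i)))"
      using P unfolding neg_log_deriv_iff by simp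
    then show "of_nat n * G $ n = - (\<Sum>i=0..n. G $ i * Q $ (n - i))"
      by (simp add: G_def Q_def mult minus sum nat)
  qed
  have "G $ k \<in> Zsym" for k
  proof (rule dilated_log_series_in[OF Z _ \<open>m > 0\<close> _ _ P Q])
    show "F $ k \<in> Zsym" for k
      by (simp add: F_def alt_p_hat_series_def int_subalgebra_sign_iff[OF Z] p_hat_in_Zsym)
    show "F $ 0 = 1" "G $ 0 = 1"
      by (simp_all add: G_def F_def alt_p_hat_series_def p_hat_0 one)
    \<comment> \<open>At \<open>r = 0\<close> both sides vanish; \<open>m > 0\<close> keeps
      \<open>m * r\<close> positive for all other \<open>r\<close>.\<close>
    show "Q $ r = p_series $ (m * r)" for r
      using \<open>m > 0\<close> by (simp add: Q_def p_series_def zero assms(3))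
  qed
  then have lam_p_hat: "lam (p_hat k) \<in> Zsym" for k
    using int_subalgebra_sign_iff[OF Z] by (simp add: G_def F_def alt_p_hat_series_def mult sign)
  \<comment> \<open>The preimage of a subring is a subring, so checking the generators
    suffices.\<close>
  have "int_subalgebra {x. lam x \<in> Zsym}"
    using Z by (auto simp: int_subalgebra_def one diff mult)
  then have "int_subalgebra hull {p_hat k |k. k > 0} \<subseteq> {x. lam x \<in> Zsym}"
    by (intro hull_minimal) (auto intro: lam_p_hat)
  then show ?thesis by (auto simp: Zsym_def)
qed

end
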